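(* Let $n\ge1$ and let $\mathcal{F}$ consist of probability distributions $P$ for $Y=(Y_1,\dots,Y_n)\in\{0,1\}^n$ such that there is a latent variable $Z$ (a random variable jointly distributed with $Y$, possibly depending on $P$) for which (i) for almost all $Z$, the vector $\mathbb{E}_P[Y\mid Z]$ induces the same total preorder on $\{1,\dots,n\}$ as the vector $\mathbb{E}_P[\alpha(Y)\mid Z]$, and (ii) this preorder is the same for almost all $Z$. Then $\mathrm{AUC}$ is a strictly $R^*$-proper scoring function for $\mathcal{F}$.
   Context: $\Xi_n$ is the set of total preorders on $\{1,\dots,n\}$; for $\precsim\,\in\Xi_n$, $i\succsim j$ means $j\precsim i$. The rank vector is $\rho_i(\precsim)=\sum_{j=1}^n\left(\mathbf 1_{j\precsim i}-\mathbf 1_{j\succsim i}\right)$. A vector $v\in\mathbb{R}^n$ induces the total preorder $\precsim_v$ given by $i\precsim_v j\Leftrightarrow v_i\le v_j$. For $y\in\{0,1\}^n$ let $n_1(y)=\sum_i y_i$, $n_0(y)=n-n_1(y)$, and let $\alpha_i(y)=\dfrac{y_i}{n_0(y)n_1(y)}$ if $n_1(y)\notin\{0,n\}$ and $\alpha_i(y)=0$ otherwise; $\alpha=(\alpha_1,\dots,\alpha_n)$. The empirical area under the curve is $$\mathrm{AUC}(y,\precsim)=\tfrac12+\tfrac12\sum_{i=1}^n\alpha_i(y)\rho_i(\precsim).$$ For a distribution $P$ on $\{0,1\}^n$, $R(P)$ is the total preorder induced by $(P[Y_1=1],\dots,P[Y_n=1])$, and $R^*(P)$ is the set of all $\precsim\,\in\Xi_n$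 contained in $R(P)$ (i.e. $i\precsim j$ implies that $(i,j)\in R(P)$). A function $s:\{0,1\}^n\times\Xi_n\to\mathbb{R}$ is strictly $R^*$-proper for $\mathcal{F}$ if for all $P\in\mathcal{F}$, all $u\in\Xi_n$ and all $t\in R^*(P)$, $\mathbb{E}_P[s(Y,u)]\le\mathbb{E}_P[s(Y,t)]$, with equality only if $u\in R^*(P)$. *)

theory Defs
  imports "HOL-Probability.Probability"
begin

definition binary_vectors :: "nat \<Rightarrow> (nat \<Rightarrow> real) set" where
  "binary_vectors n = {1..n} \<rightarrow>\<^sub>E {0, 1}"

text \<open>A preorder is a set of pairs; \<open>(i, j) \<in> r\<close> means that \<open>i\<close> is ranked below or level with \<open>j\<close>.\<close>

definition total_preorders :: "nat \<Rightarrow> nat rel set" where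
  "total_preorders n = {r. preorder_on {1..n} r \<and> total_on {1..n} r}"

definition rank_vec :: "nat \<Rightarrow> nat rel \<Rightarrow> nat \<Rightarrow> real" where
  "rank_vec n r i = (\<Sum>j=1..n. of_bool ((j, i) \<in> r) - of_bool ((i, j) \<in> r))"

definition induced_preorder :: "nat \<Rightarrow> (nat \<Rightarrow> real) \<Rightarrow> nat rel" where
  "induced_preorder n v = {(i, j). i \<in> {1..n} \<and> j \<in> {1..n} \<and> v i \<le> v j}"

definition num_ones :: "nat \<Rightarrow> (nat \<Rightarrow> real) \<Rightarrow> real" where
  "num_ones n y = (\<Sum>i=1..n. y i)"

definition num_zeros :: "nat \<Rightarrow> (nat \<Rightarrow> real) \<Rightarrow> real" where
  "num_zeros n y = real n - num_ones n y"

definition alpha :: "nat \<Rightarrow> (nat \<Rightarrow> real) \<Rightarrow> nat \<Rightarrow> real" where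
  "alpha n y i =
    (if num_ones n y \<notin> {0, real n} then y i / (num_zeros n y * num_ones n y) else 0)"

definition AUC :: "nat \<Rightarrow> (nat \<Rightarrow> real) \<Rightarrow> nat rel \<Rightarrow> real" where
  "AUC n y r = 1/2 + 1/2 * (\<Sum>i=1..n. alpha n y i * rank_vec n r i)"

text \<open>The probability distributions on \<open>{0,1}\<^sup>n\<close>, every subset of which is measurable.\<close>

definition binary_distributions :: "nat \<Rightarrow> (nat \<Rightarrow> real) measure set" where
  "binary_distributions n =
    {P. prob_space P \<and> sets P = sets (count_space (binary_vectors n))}"

definition R :: "nat \<Rightarrow> (nat \<Rightarrow> real) measure \<Rightarrow> nat rel" where
  "R n P = induced_preorder n (\<lambda>i. measure P {y \<in> space P. y i = 1})"

definition R_star :: "nat \<Rightarrow> (nat \<Rightarrow> real) measure \<Rightarrow> nat rel set" where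
  "R_star n P = {r \<in> total_preorders n. r \<subseteq> R n P}"

definition strictly_proper ::
  "nat \<Rightarrow> ((nat \<Rightarrow> real) measure \<Rightarrow> nat rel set) \<Rightarrow> (nat \<Rightarrow> real) measure set
    \<Rightarrow> ((nat \<Rightarrow> real) \<Rightarrow> nat rel \<Rightarrow> real) \<Rightarrow> bool" where
  "strictly_proper n T \<F> s \<longleftrightarrow>
    (\<forall>P\<in>\<F>. \<forall>u\<in>total_preorders n. \<forall>t\<in>T P.
      (\<integral>y. s y u \<partial>P) \<le> (\<integral>y. s y t \<partial>P) \<and>
      ((\<integral>y. s y u \<partial>P) = (\<integral>y. s y t \<partial>P) \<longrightarrow> u \<in> T P))"

text \<open>\<open>M\<close> is a common sample space for \<open>Y\<close> and \<open>Z\<close>; the law of \<open>Y\<close> is \<open>P\<close>, and \<open>Z\<close> takes values in an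
  arbitrary measurable space \<open>N\<close>.\<close>

definition latent_variable ::
  "(nat \<Rightarrow> real) measure \<Rightarrow> 'a measure \<Rightarrow> ('a \<Rightarrow> nat \<Rightarrow> real) \<Rightarrow> 'b measure \<Rightarrow> ('a \<Rightarrow> 'b) \<Rightarrow> bool"
  where
  "latent_variable P M Y N Z \<longleftrightarrow>
    prob_space M \<and> Y \<in> measurable M P \<and> distr M P Y = P \<and> Z \<in> measurable M N"

definition cond_expectation_given ::
  "'a measure \<Rightarrow> 'b measure \<Rightarrow> ('a \<Rightarrow> 'b) \<Rightarrow> ('a \<Rightarrow> real) \<Rightarrow> 'a \<Rightarrow> real" where
  "cond_expectation_given M N Z f = real_cond_exp M (vimage_algebra (space M) Z N) f"

definition cond_mean_preorder ::
  "nat \<Rightarrow> 'a measure \<Rightarrow> 'b measure \<Rightarrow> ('a \<Rightarrow> 'b) \<Rightarrow> ('a \<Rightarrow> nat \<Rightarrow> real) \<Rightarrow> 'a \<Rightarrow> nat rel" where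
  "cond_mean_preorder n M N Z X \<omega> =
    induced_preorder n (\<lambda>i. cond_expectation_given M N Z (\<lambda>\<omega>'. X \<omega>' i) \<omega>)"

end

theory Submission
  imports Defs
begin

text \<open>
  Put \<open>a\<^sub>i = E \<alpha>\<^sub>i(Y)\<close>. Up to constants, the expected score of a preorder \<open>r\<close> is the sum over all pairs
  \<open>(i, j)\<close> of \<open>(a\<^sub>i - a\<^sub>j) s\<^sub>i\<^sub>j\<close>, where \<open>s\<^sub>i\<^sub>j\<close> in \<open>{-1, 0, 1}\<close> records how \<open>r\<close> orders \<open>i\<close> and \<open>j\<close>. This is at most
  the sum of the \<open>\<bar>a\<^sub>i - a\<^sub>j\<bar>\<close>, and it reaches that bound exactly when \<open>r\<close> refines the preorder
  induced by \<open>a\<close>. That preorder is \<open>R(P)\<close>: a weak or strict inequality between conditional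
  expectations that holds almost surely survives integration over \<open>Z\<close>, so \<open>a\<close> and
  \<open>(P[Y\<^sub>i = 1])\<^sub>i\<close> both induce the common conditional preorder.
\<close>

text \<open>Isolating the summand of \<open>rank_vec\<close> exposes its antisymmetry in
  \<open>i\<close> and \<open>j\<close>.\<close>

definition rank_sign :: "nat rel \<Rightarrow> nat \<Rightarrow> nat \<Rightarrow> real" where
  "rank_sign r i j = of_bool ((j, i) \<in> r) - of_bool ((i, j) \<in> r)"

text \<open>By antisymmetry of \<open>rank_sign\<close>, interchanging the two summation indices
  rewrites the same sum with weights \<open>- a j\<close>; adding both versions produces the
  differences.\<close>

lemma sum_rank_vec:
  "2 * (\<Sum>i=1..n. a i * rank_vec n r i) = (\<Sum>i=1..n. \<Sum>j=1..n. (a i - a j) * rank_sign r i j)"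
proof -
  have left: "(\<Sum>i=1..n. a i * rank_vec n r i) = (\<Sum>i=1..n. \<Sum>j=1..n. a i * rank_sign r i j)"
    by (simp add: rank_vec_def rank_sign_def sum_distrib_left)
  also have "\<dots> = (\<Sum>i=1..n. \<Sum>j=1..n. a j * rank_sign r j i)"
    by (rule sum.swap)
  also have "\<dots> = (\<Sum>i=1..n. \<Sum>j=1..n. - (a j * rank_sign r i j))"
    by (intro sum.cong refl) (simp add: rank_sign_def algebra_simps)
  finally have right: "(\<Sum>i=1..n. a i * rank_vec n r i) = \<dots>" .
  have "2 * (\<Sum>i=1..n. a i * rank_vec n r i)
      = (\<Sum>i=1..n. \<Sum>j=1..n. a i * rank_sign r i j) + (\<Sum>i=1..n. \<Sum>j=1..n. - (a j * rank_sign r i j))"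
    using left right by linarith
  then show ?thesis
    by (simp only: sum.distrib[symmetric] left_diff_distrib add_uminus_conv_diff)
qed

lemma diff_mult_rank_sign_le: "(a i - a j) * rank_sign r i j \<le> \<bar>a i - a j\<bar>"
  by (auto simp: rank_sign_def)

lemma sum_rank_vec_le:
  "2 * (\<Sum>i=1..n. a i * rank_vec n r i) \<le> (\<Sum>i=1..n. \<Sum>j=1..n. \<bar>a i - a j\<bar>)"
  unfolding sum_rank_vec by (intro sum_mono diff_mult_rank_sign_le)

text \<open>The sums agree only if they agree term by term. A term with \<open>a i = a j\<close>
  imposes nothing; any other is tight only if \<open>r\<close> orders \<open>i\<close> and
  \<open>j\<close> strictly, in the direction of \<open>a\<close>. Totality serves the direction
  from inclusion to equality: an incomparable pair would contribute 0.\<close>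

lemma sum_rank_vec_eq_iff:
  assumes r: "r \<in> total_preorders n"
  shows "2 * (\<Sum>i=1..n. a i * rank_vec n r i) = (\<Sum>i=1..n. \<Sum>j=1..n. \<bar>a i - a j\<bar>)
    \<longleftrightarrow> r \<subseteq> induced_preorder n a"
proof
  assume sub: "r \<subseteq> induced_preorder n a"
  have "(a i - a j) * rank_sign r i j = \<bar>a i - a j\<bar>" if "i \<in> {1..n}" "j \<in> {1..n}" for i j
  proof (cases "a i = a j")
    case False
    then have "i \<noteq> j" by blast
    with that r have "(i, j) \<in> r \<or> (j, i) \<in> r"
      by (simp add: total_preorders_def total_on_def)
    moreover have "(i, j) \<in> r \<Longrightarrow> a i \<le> a j" "(j, i) \<in> r \<Longrightarrow> a j \<le> a i"
      using sub by (auto simp: induced_preorder_def)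
    \<comment> \<open>Both memberships together would force \<open>a i = a j\<close>, so exactly one
      holds and the sign is that of \<open>a i - a j\<close>.\<close>
    ultimately show ?thesis
      using False by (cases "(i, j) \<in> r"; cases "(j, i) \<in> r") (simp_all add: rank_sign_def)
  qed simp
  then show "2 * (\<Sum>i=1..n. a i * rank_vec n r i) = (\<Sum>i=1..n. \<Sum>j=1..n. \<bar>a i - a j\<bar>)"
    unfolding sum_rank_vec by (intro sum.cong refl) auto
next
  assume eq: "2 * (\<Sum>i=1..n. a i * rank_vec n r i) = (\<Sum>i=1..n. \<Sum>j=1..n. \<bar>a i - a j\<bar>)"
  \<comment> \<open>The slacks are nonnegative and sum to zero, so each of them vanishes.\<close>
  have "(\<Sum>(i, j)\<in>{1..n} \<times> {1..n}. \<bar>a i - a j\<bar> - (a i - a j) * rank_sign r i j) = 0"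
    using eq unfolding sum_rank_vec by (simp add: sum.cartesian_product[symmetric] sum_subtractf)
  then have zero: "\<forall>(i, j)\<in>{1..n} \<times> {1..n}. \<bar>a i - a j\<bar> - (a i - a j) * rank_sign r i j = 0"
    by (subst (asm) sum_nonneg_eq_0_iff) (auto simp: diff_mult_rank_sign_le)
  have r_sub: "r \<subseteq> {1..n} \<times> {1..n}"
    using r by (auto simp: total_preorders_def preorder_on_def refl_on_def)
  have "a i \<le> a j" if ij: "(i, j) \<in> r" for i j
  proof -
    have "(i, j) \<in> {1..n} \<times> {1..n}"
      using ij r_sub by (rule rev_subsetD)
    with zero have "\<bar>a i - a j\<bar> = (a i - a j) * rank_sign r i j"
      by auto
    \<comment> \<open>A tie has sign 0 and forces \<open>a i = a j\<close>; otherwise the sign is -1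
      and \<open>a j - a i\<close> equals an absolute value.\<close>
    with ij show ?thesis
      by (cases "(j, i) \<in> r") (simp_all add: rank_sign_def)
  qed
  with r_sub show "r \<subseteq> induced_preorder n a"
    unfolding induced_preorder_def by blast
qed

lemma measurable_binary_distribution:
  assumes "P \<in> binary_distributions n"
  shows "f \<in> borel_measurable P"
proof -
  have "sets P = sets (count_space (binary_vectors n))"
    using assms by (simp add: binary_distributions_def)
  then show ?thesis
    by (simp only: measurable_cong_sets[OF _ refl, of P "count_space (binary_vectors n)"])
      simp
qed

lemma space_binary_distribution:
  assumes "P \<in> binary_distributions n"
  shows "space P = binary_vectors n"
  using assms sets_eq_imp_space_eq[of P "count_space (binary_vectors n)"]
  by (simp add: binary_distributions_def)

lemma finite_binary_vectors: "finite (binary_vectors n)"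
  by (simp add: binary_vectors_def finite_PiE)

lemma integrable_binary_distribution:
  fixes f :: "(nat \<Rightarrow> real) \<Rightarrow> real"
  assumes P: "P \<in> binary_distributions n"
  shows "integrable P f"
proof -
  interpret prob_space P
    using P by (simp add: binary_distributions_def)
  obtain B where "\<And>y. y \<in> binary_vectors n \<Longrightarrow> norm (f y) \<le> B"
    using finite_imp_bounded[OF finite_imageI[OF finite_binary_vectors], of f n]
    unfolding bounded_iff by blast
  then show ?thesis
    by (intro integrable_const_bound[of _ B] AE_I2 measurable_binary_distribution[OF P])
      (simp add: space_binary_distribution[OF P])
qed

text \<open>On binary vectors a coordinate is the indicator of its being 1. Thus \<open>R\<close>
  compares means, just as the preorder of the expected \<alpha> does.\<close>

lemma integral_coord:
  assumes P: "P \<in> binary_distributions n" and i: "i \<in> {1..n}"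
  shows "(\<integral>y. y i \<partial>P) = measure P {y \<in> space P. y i = 1}"
proof -
  interpret prob_space P
    using P by (simp add: binary_distributions_def)
  have meas: "{y \<in> space P. y i = 1} \<in> sets P"
    using measurable_sets[OF measurable_binary_distribution[OF P, of "\<lambda>y. y i"], of "{1}"]
    by (simp add: vimage_def Int_def conj_commute)
  have "(\<integral>y. y i \<partial>P) = (\<integral>y. indicator {y \<in> space P. y i = 1} y \<partial>P)"
    using i by (intro Bochner_Integration.integral_cong)
      (auto simp: space_binary_distribution[OF P] binary_vectors_def indicator_def PiE_iff)
  then show ?thesis
    using meas by simp
qed

lemma integral_AUC:
  assumes P: "P \<in> binary_distributions n"
  shows "(\<integral>y. AUC n y r \<partial>P) = 1/2 + 1/2 * (\<Sum>i=1..n. (\<integral>y. alpha n y i \<partial>P) * rank_vec n r i)"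
proof -
  interpret prob_space P
    using P by (simp add: binary_distributions_def)
  show ?thesis
    unfolding AUC_def by (simp add: integrable_binary_distribution[OF P] prob_space)
qed

text \<open>Strictness survives because the set where it holds has measure 1, not 0.\<close>

lemma (in prob_space) integral_strict_mono_AE:
  fixes f g :: "'a \<Rightarrow> real"
  assumes "integrable M f" "integrable M g" "AE x in M. f x < g x"
  shows "integral\<^sup>L M f < integral\<^sup>L M g"
  using assms by (intro integral_less_AE_space) (auto simp: emeasure_space_1)

lemma induced_preorder_cond_expectation:
  assumes M: "prob_space M" and Z: "Z \<in> measurable M N"
    and X: "\<And>i. i \<in> {1..n} \<Longrightarrow> integrable M (\<lambda>\<omega>. X \<omega> i)"
    and r: "AE \<omega> in M. cond_mean_preorder n M N Z X \<omega> = r"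
  shows "induced_preorder n (\<lambda>i. \<integral>\<omega>. X \<omega> i \<partial>M) = r"
proof -
  interpret prob_space M by (rule M)
  let ?G = "vimage_algebra (space M) Z N"
  have "subalgebra M ?G"
    using Z by (auto simp: subalgebra_def sets_vimage_algebra2 measurable_def)
  then interpret finite_measure_subalgebra M ?G
    by unfold_locales
  let ?C = "\<lambda>i. cond_expectation_given M N Z (\<lambda>\<omega>. X \<omega> i)"
  have int: "integrable M (?C i)" and eq: "(\<integral>\<omega>. X \<omega> i \<partial>M) = integral\<^sup>L M (?C i)"
    if "i \<in> {1..n}" for i
    using real_cond_exp_int[OF X[OF that]] by (simp_all add: cond_expectation_given_def)
  \<comment> \<open>An almost sure property holds somewhere on a probability space; one such point
    shows that \<open>r\<close> relates only indices in \<open>{1..n}\<close>.\<close>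
  obtain \<omega>0 where "cond_mean_preorder n M N Z X \<omega>0 = r"
    using eventually_happens[OF r] by (auto simp: ae_filter_bot)
  then have r_sub: "r \<subseteq> {1..n} \<times> {1..n}"
    by (auto simp: cond_mean_preorder_def induced_preorder_def)
  have "(\<integral>\<omega>. X \<omega> i \<partial>M) \<le> (\<integral>\<omega>. X \<omega> j \<partial>M) \<longleftrightarrow> (i, j) \<in> r"
    if ij: "i \<in> {1..n}" "j \<in> {1..n}" for i j
  proof (cases "(i, j) \<in> r")
    case True
    with r have "AE \<omega> in M. ?C i \<omega> \<le> ?C j \<omega>"
      by (auto simp: cond_mean_preorder_def induced_preorder_def elim!: eventually_mono)
    then have "integral\<^sup>L M (?C i) \<le> integral\<^sup>L M (?C j)"
      by (intro integral_mono_AE int ij)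
    with True eq ij show ?thesis by simp
  next
    case False
    \<comment> \<open>Since the order on the reals is total, a pair missing from \<open>r\<close>
      means a strict reverse inequality.\<close>
    with r ij have "AE \<omega> in M. ?C j \<omega> < ?C i \<omega>"
      by (auto simp: cond_mean_preorder_def induced_preorder_def elim!: eventually_mono)
    then have "integral\<^sup>L M (?C j) < integral\<^sup>L M (?C i)"
      by (intro integral_strict_mono_AE int ij)
    with False eq ij show ?thesis by simp
  qed
  with r_sub show ?thesis
    by (auto simp: induced_preorder_def)
qed

text \<open>Change of variables moves the means from the common sample space to the law
  \<open>P\<close>. A general \<open>f\<close> covers both uses: the identity and \<alpha>.\<close>

lemma induced_preorder_mean_eq:
  assumes P: "P \<in> binary_distributions n" and L: "latent_variable P M Y N Z"
    and r: "AE \<omega> in M. cond_mean_preorder n M N Z (\<lambda>\<omega>. f (Y \<omega>)) \<omega> = r"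
  shows "induced_preorder n (\<lambda>i. \<integral>y. f y i \<partial>P) = r"
proof -
  have M: "prob_space M" and Y: "Y \<in> measurable M P" and D: "distr M P Y = P"
    and Z: "Z \<in> measurable M N"
    using L by (auto simp: latent_variable_def)
  have "integrable M (\<lambda>\<omega>. f (Y \<omega>) i)" for i
    using integrable_distr[OF Y, of "\<lambda>y. f y i"] integrable_binary_distribution[OF P]
    by (simp add: D)
  moreover have "(\<integral>\<omega>. f (Y \<omega>) i \<partial>M) = (\<integral>y. f y i \<partial>P)" for i
    using integral_distr[OF Y measurable_binary_distribution[OF P], of "\<lambda>y. f y i"]
    by (simp add: D)
  ultimately show ?thesis
    using induced_preorder_cond_expectation[OF M Z _ r] by simp
qed

theorem theorem6:
  fixes n :: nat and \<F> :: "(nat \<Rightarrow> real) measure set"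
  assumes "n \<ge> 1"
    and "\<F> \<subseteq> binary_distributions n"
    and "\<forall>P\<in>\<F>. \<exists>(M :: 'a measure) Y (N :: 'b measure) Z.
      latent_variable P M Y N Z \<and>
      (AE \<omega> in M. cond_mean_preorder n M N Z Y \<omega> =
         cond_mean_preorder n M N Z (\<lambda>\<omega>'. alpha n (Y \<omega>')) \<omega>) \<and>
      (\<exists>r. AE \<omega> in M. cond_mean_preorder n M N Z Y \<omega> = r)"
  shows "strictly_proper n (R_star n) \<F> (AUC n)"
  unfolding strictly_proper_def
proof (intro ballI)
  fix P u t
  assume "P \<in> \<F>" and u: "u \<in> total_preorders n" and "t \<in> R_star n P"
  then have P: "P \<in> binary_distributions n" and t: "t \<in> total_preorders n" "t \<subseteq> R n P"
    using assms(2) by (auto simp: R_star_def)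
  obtain M :: "'a measure" and Y and N :: "'b measure" and Z r where
    L: "latent_variable P M Y N Z"
    and same: "AE \<omega> in M. cond_mean_preorder n M N Z Y \<omega> =
      cond_mean_preorder n M N Z (\<lambda>\<omega>'. alpha n (Y \<omega>')) \<omega>"
    and r: "AE \<omega> in M. cond_mean_preorder n M N Z Y \<omega> = r"
    using assms(3) \<open>P \<in> \<F>\<close> by blast
  define a where "a i = (\<integral>y. alpha n y i \<partial>P)" for i
  have "R n P = induced_preorder n (\<lambda>i. \<integral>y. y i \<partial>P)"
    by (auto simp: R_def induced_preorder_def integral_coord[OF P])
  also have "\<dots> = r"
    using induced_preorder_mean_eq[OF P L, of "\<lambda>y. y"] r by simp
  also have "r = induced_preorder n a"
  proof -
    have "AE \<omega> in M. cond_mean_preorder n M N Z (\<lambda>\<omega>'. alpha n (Y \<omega>')) \<omega> = r"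
      using same r by eventually_elim simp
    then show ?thesis
      unfolding a_def using induced_preorder_mean_eq[OF P L, of "alpha n"] by simp
  qed
  finally have R: "R n P = induced_preorder n a" .
  have "R_star n P = {r \<in> total_preorders n. r \<subseteq> induced_preorder n a}"
    by (simp add: R_star_def R)
  moreover have "(\<integral>y. AUC n y r \<partial>P) = 1/2 + 1/2 * (\<Sum>i=1..n. a i * rank_vec n r i)" for r
    by (simp only: integral_AUC[OF P] a_def)
  \<comment> \<open>The bound does not depend on the preorder, and \<open>t\<close> attains it. If
    \<open>u\<close> scores equally well, it attains the bound too, so the equality criterion puts
    it in \<open>R_star n P\<close>.\<close>
  ultimately show "(\<integral>y. AUC n y u \<partial>P) \<le> (\<integral>y. AUC n y t \<partial>P) \<and>
      ((\<integral>y. AUC n y u \<partial>P) = (\<integral>y. AUC n y t \<partial>P) \<longrightarrow> u \<in> R_star n P)"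
    using sum_rank_vec_le[of a n u] sum_rank_vec_eq_iff[OF u, of a]
      sum_rank_vec_eq_iff[OF t(1), of a] t(2) u
    unfolding R by (intro conjI impI) simp_all
qed

end
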